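(* Let $k,s,t$ be integers with $2 \leq k < s$ and $k < t$, and let $m = \tilde{r}_{k-1}(s-1,t-1)$. Then in the $2$-color $k$-uniform vertex online Ramsey game for cliques of sizes $s$ and $t$, builder has a strategy that, against every painter strategy, forces painter to create a copy of $K_s^{(k)}$ all of whose edges have color $1$ or a copy of $K_t^{(k)}$ all of whose edges have color $2$, while revealing at most $2^m + k - 2$ vertices and building at most $m \cdot 2^m$ edges. In particular, \[ r_k(s,t) \leq 2^{\tilde{r}_{k-1}(s-1,t-1)} + k - 2 \] and \[ \tilde{r}_k(s,t) \leq \tilde{r}_{k-1}(s-1,t-1) \cdot 2^{\tilde{r}_{k-1}(s-1,t-1)} = 2^{(1+o(1))\tilde{r}_{k-1}(s-1,t-1)}, \] where the $o(1)$ term tends to $0$ as $\max\{s,t\}\to\infty$.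
   Context: $K_n^{(k)}$ denotes the complete $k$-uniform hypergraph on $n$ vertices. For integers $k < t_1,\dots,t_q$, the Ramsey number $r_k(t_1,\dots,t_q)$ is the least $n$ such that every $q$-coloring of the edges of $K_n^{(k)}$ contains, for some color $c\in[q]$, a copy of $K_{t_c}^{(k)}$ all of whose edges have color $c$. The $q$-color $k$-uniform vertex online Ramsey game for cliques of sizes $t_1,\dots,t_q$ (with $k<t_1,\dots,t_q$) is played by builder and painter on an ordered vertex set $v_1,v_2,\dots$ of an initially empty $k$-uniform hypergraph, in rounds. At the start of round $i$ the vertex $v_i$ is revealed. During round $i$, builder may build any number of edges of the form $\{v_{i_1},\dots,v_{i_{k-1}},v_i\}$ with $i_1<\dots<i_{k-1}<i$, in any order (adaptively); whenever an edge is built, painter must immediately assign it a color from $[q]$. In each round $i\geq k$ builder must build at least one new edge. Builder's goal is to force, for some $c\in[q]$, a copy of $K_{t_c}^{(k)}$ all of whose edges are built and have color $c$; painter tries to delay this. The $k$-uniform vertex online Ramsey number $\tilde{r}_k(t_1,\dots,t_q)$ is the minimum number of edges builder must build to force such a monochromatic clique against any painter strategy. For $q=2$ write $\tilde{r}_k(s,t)$ and $r_k(s,t)$ (cliques of size $s$ in color $1$ and size $t$ in color $2$). These definitions are also used for uniformity $1$ (when $k=2$, the quantity $\tilde r_{1}$ appears). *)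

theory Defs
  imports Complex_Main "HOL-Library.Ramsey"
begin

text \<open>
  The list \<open>ts\<close> of clique sizes determines the number \<open>q = length ts\<close> of colours.  Following
  \<^const>\<open>partn_lst\<close>, colours are numbered from \<open>0\<close>, so colour \<open>c < q\<close> here is colour \<open>c + 1\<close> of the
  usual convention, and \<open>ts ! c\<close> is the size of the clique sought in it.
\<close>

definition ramsey_number :: "nat \<Rightarrow> nat list \<Rightarrow> nat" where
  "ramsey_number k ts = (LEAST n. partn_lst {..<n} ts k)"

text \<open>
  The vertex \<open>v\<^sub>i\<close> is the natural number \<open>i \<ge> 1\<close>.  A position of the game records the number of
  vertices revealed so far, which is also the number of the current round (\<open>0\<close> before the
  first one), and the edges built so far with their colours, in chronological order.  An edge
  is always built in the round of its largest vertex, and only rounds before round \<open>k\<close> can be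
  without an edge, so a position determines the complete history of the play, and strategies
  may depend on all of it.
\<close>

datatype position = Position (revealed: nat) (built: "(nat set \<times> nat) list")

datatype builder_move = Reveal | Build "nat set"

type_synonym builder = "position \<Rightarrow> builder_move"

type_synonym painter = "position \<Rightarrow> nat set \<Rightarrow> nat"

text \<open>
  \<^const>\<open>Reveal\<close> ends the current round and starts the next one; this is forbidden in a round
  \<open>i \<ge> k\<close> in which no edge has been built yet.
\<close>

fun legal_move :: "nat \<Rightarrow> position \<Rightarrow> builder_move \<Rightarrow> bool" where
  "legal_move k p Reveal \<longleftrightarrow>
     revealed p < k \<or> (\<exists>(e, c) \<in> set (built p). revealed p \<in> e)"
| "legal_move k p (Build e) \<longleftrightarrow>
     e \<in> nsets {1..revealed p} k \<and> revealed p \<in> e \<and> e \<notin> fst ` set (built p)"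

fun make_move :: "painter \<Rightarrow> position \<Rightarrow> builder_move \<Rightarrow> position" where
  "make_move \<pi> p Reveal = Position (Suc (revealed p)) (built p)"
| "make_move \<pi> p (Build e) = Position (revealed p) (built p @ [(e, \<pi> p e)])"

primrec play :: "builder \<Rightarrow> painter \<Rightarrow> nat \<Rightarrow> position" where
  "play \<beta> \<pi> 0 = Position 0 []"
| "play \<beta> \<pi> (Suc n) = make_move \<pi> (play \<beta> \<pi> n) (\<beta> (play \<beta> \<pi> n))"

definition painter_strategy :: "nat list \<Rightarrow> painter \<Rightarrow> bool" where
  "painter_strategy ts \<pi> \<longleftrightarrow> (\<forall>p e. \<pi> p e < length ts)"

definition has_mono_clique :: "nat \<Rightarrow> nat list \<Rightarrow> position \<Rightarrow> bool" where
  "has_mono_clique k ts p \<longleftrightarrow>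
     (\<exists>c < length ts. \<exists>H \<in> nsets {1..revealed p} (ts ! c). \<forall>e \<in> nsets H k. (e, c) \<in> set (built p))"

text \<open>
  Against every painter, playing \<open>\<beta>\<close> leads by legal moves to a position that contains a
  monochromatic clique and satisfies the bound \<open>P\<close>.
\<close>

definition builder_forces :: "nat \<Rightarrow> nat list \<Rightarrow> builder \<Rightarrow> (position \<Rightarrow> bool) \<Rightarrow> bool" where
  "builder_forces k ts \<beta> P \<longleftrightarrow>
     (\<forall>\<pi>. painter_strategy ts \<pi> \<longrightarrow>
        (\<exists>n. (\<forall>j<n. legal_move k (play \<beta> \<pi> j) (\<beta> (play \<beta> \<pi> j))) \<and>
             has_mono_clique k ts (play \<beta> \<pi> n) \<and> P (play \<beta> \<pi> n)))"

text \<open>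
  If \<open>ts\<close> is nonempty and all its entries exceed \<open>k \<ge> 1\<close>, the minimum below exists: by Ramsey's
  theorem, building all edges on sufficiently many vertices succeeds.
\<close>

definition online_ramsey_number :: "nat \<Rightarrow> nat list \<Rightarrow> nat" where
  "online_ramsey_number k ts =
     (LEAST m. \<exists>\<beta>. builder_forces k ts \<beta> (\<lambda>p. length (built p) \<le> m))"

end

theory Submission
  imports Defs
begin

text \<open>
  Builder keeps an optimal strategy for the \<open>(k - 1)\<close>-uniform game and turns its game tree into
  a growing tree of vertices of the \<open>k\<close>-uniform game.  A new vertex \<open>v\<close> walks down from the root:
  where the \<open>(k - 1)\<close>-uniform strategy builds \<open>e\<close>, builder builds \<open>e \<union> {v}\<close> and
  painter's colour decides the branch; where it reveals a vertex, \<open>v\<close> passes on if an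
  earlier vertex already occupies this node, and otherwise occupies it.  The colour of an edge then
  depends only on the branch of its last vertex, so a walk that completes a
  monochromatic clique of the \<open>(k - 1)\<close>-uniform game completes, together with \<open>v\<close>, one of the
  \<open>k\<close>-uniform game.  Apart from \<open>k - 2\<close> nodes at the top, the occupied nodes are told apart
  by their sequences of fewer than \<open>m\<close> colours, and each vertex costs at most \<open>m\<close> edges.
\<close>

section \<open>From bounded wins to builder strategies\<close>

text \<open>
  The number of moves in \<open>wins\<close> serves as a rank: by picking at each position a move that lowers
  the least rank, builder obtains a strategy, with no memory beyond the position.
\<close>

fun wins :: "nat \<Rightarrow> nat list \<Rightarrow> (position \<Rightarrow> bool) \<Rightarrow> nat \<Rightarrow> position \<Rightarrow> bool" where
  "wins k ts P 0 p \<longleftrightarrow> has_mono_clique k ts p \<and> P p"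
| "wins k ts P (Suc n) p \<longleftrightarrow> has_mono_clique k ts p \<and> P p \<or>
     (\<exists>mv. legal_move k p mv \<and> (\<forall>c<length ts. wins k ts P n (make_move (\<lambda>_ _. c) p mv)))"

lemma wins_mono: "wins k ts P n p \<Longrightarrow> n \<le> n' \<Longrightarrow> wins k ts P n' p"
proof (induction n arbitrary: n' p)
  case 0
  then show ?case by (cases n') auto
next
  case (Suc n)
  then obtain l where "n' = Suc l" "n \<le> l" by (cases n') auto
  with Suc.prems(1) Suc.IH show ?case by (simp, blast)
qed

lemma wins_SucI:
  assumes "legal_move k p mv" "\<And>c. c < length ts \<Longrightarrow> wins k ts P n (make_move (\<lambda>_ _. c) p mv)"
  shows "wins k ts P (Suc n) p"
  unfolding wins.simps using assms by blast

lemma winsI: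
  assumes "legal_move k p mv" "ts \<noteq> []"
    and "\<And>c. c < length ts \<Longrightarrow> \<exists>n'<n. wins k ts P n' (make_move (\<lambda>_ _. c) p mv)"
  shows "wins k ts P n p"
proof (cases n)
  case 0
  then show ?thesis using assms(2) assms(3)[of 0] by simp
next
  case (Suc l)
  show ?thesis unfolding Suc
  proof (rule wins_SucI[OF assms(1)])
    fix c assume "c < length ts"
    then obtain n' where "n' \<le> l" "wins k ts P n' (make_move (\<lambda>_ _. c) p mv)"
      using assms(3) Suc by (auto simp: less_Suc_eq_le)
    then show "wins k ts P l (make_move (\<lambda>_ _. c) p mv)" by (blast intro: wins_mono)
  qed
qed

text \<open>A single move consults painter at most once, so painter's influence on it is one colour.
  This is why \<open>wins\<close> may quantify over colours instead of painters.\<close>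

lemma make_move_const:
  assumes "painter_strategy ts \<pi>"
  shows "\<exists>c<length ts. make_move \<pi> p mv = make_move (\<lambda>_ _. c) p mv"
proof (cases mv)
  case Reveal
  then show ?thesis using assms by (auto simp: painter_strategy_def)
next
  case (Build e)
  then show ?thesis using assms by (auto simp: painter_strategy_def intro!: exI[of _ "\<pi> p e"])
qed

lemma builder_forces_if_wins:
  assumes "wins k ts P n (Position 0 [])"
  shows "\<exists>\<beta>. builder_forces k ts \<beta> P"
proof -
  define rank where "rank p = (LEAST n. wins k ts P n p)" for p
  define good where "good p mv \<longleftrightarrow> legal_move k p mv \<and>
    (\<forall>c<length ts. wins k ts P (rank p - 1) (make_move (\<lambda>_ _. c) p mv))" for p mv
  define \<beta> where "\<beta> p = (SOME mv. good p mv)" for p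
  have good: "good p (\<beta> p)" "0 < rank p"
    if w: "wins k ts P l p" and nc: "\<not> (has_mono_clique k ts p \<and> P p)" for p l
  proof -
    have r: "wins k ts P (rank p) p" unfolding rank_def by (rule LeastI[of _ l]) (rule w)
    obtain l' where l': "rank p = Suc l'" using r nc by (cases "rank p") auto
    then have "\<exists>mv. good p mv" using r nc by (auto simp: good_def)
    then show "good p (\<beta> p)" unfolding \<beta>_def by (rule someI_ex)
    show "0 < rank p" using l' by simp
  qed
  \<comment> \<open>Stated from an arbitrary time \<open>i\<close>, so that the induction on the
    rank of the current position continues one and the same play.\<close>
  have "\<exists>n'\<ge>i. (\<forall>j. i \<le> j \<and> j < n' \<longrightarrow> legal_move k (play \<beta> \<pi> j) (\<beta> (play \<beta> \<pi> j))) \<and>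
          has_mono_clique k ts (play \<beta> \<pi> n') \<and> P (play \<beta> \<pi> n')"
    if \<pi>: "painter_strategy ts \<pi>" and "wins k ts P l (play \<beta> \<pi> i)" for \<pi> i l
    using that(2)
  proof (induction "rank (play \<beta> \<pi> i)" arbitrary: i l rule: less_induct)
    case less
    let ?p = "play \<beta> \<pi> i"
    show ?case
    proof (cases "has_mono_clique k ts ?p \<and> P ?p")
      case True
      then show ?thesis by (intro exI[of _ i]) auto
    next
      case False
      note g = good[OF less.prems False]
      obtain c where c: "c < length ts"
        "make_move \<pi> ?p (\<beta> ?p) = make_move (\<lambda>_ _. c) ?p (\<beta> ?p)"
        using make_move_const[OF \<pi>] by blast
      have w: "wins k ts P (rank ?p - 1) (play \<beta> \<pi> (Suc i))"
        using g(1) c by (auto simp: good_def)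
      then have "rank (play \<beta> \<pi> (Suc i)) \<le> rank ?p - 1"
        unfolding rank_def by (rule Least_le)
      then obtain n' where n': "n' \<ge> Suc i"
        "\<forall>j. Suc i \<le> j \<and> j < n' \<longrightarrow> legal_move k (play \<beta> \<pi> j) (\<beta> (play \<beta> \<pi> j))"
        "has_mono_clique k ts (play \<beta> \<pi> n')" "P (play \<beta> \<pi> n')"
        using less.hyps[OF _ w] g(2) by (metis diff_less le_less_trans zero_less_one)
      have "legal_move k ?p (\<beta> ?p)" using g(1) by (simp add: good_def)
      then show ?thesis using n'
        by (intro exI[of _ n']) (metis Suc_leD le_neq_implies_less Suc_leI)
    qed
  qed
  from this[of _ n 0] assms have "builder_forces k ts \<beta> P"
    unfolding builder_forces_def by fastforce
  then show ?thesis by blast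
qed

section \<open>Growing histories and the vertices of cliques\<close>

lemma built_play_mono:
  assumes "n \<le> n'"
  shows "\<exists>B. built (play \<beta> \<pi> n') = built (play \<beta> \<pi> n) @ B"
  using assms
proof (induction n' rule: dec_induct)
  case (step n')
  then show ?case by (cases "\<beta> (play \<beta> \<pi> n')") auto
qed simp

text \<open>Any \<open>k - 1\<close> further vertices of \<open>H\<close> complete \<open>x\<close>
  to an edge. Hence every vertex of a monochromatic clique lies on a built edge.\<close>

lemma in_mono_cliqueE:
  assumes "x \<in> H" "H \<in> nsets A t" "0 < k" "k \<le> t"
  obtains e where "x \<in> e" "e \<in> nsets H k"
proof -
  have fin: "finite H" "card H = t" using assms(2) by (auto simp: nsets_def)
  then have "k - 1 \<le> card (H - {x})" using assms by simp
  then obtain S where S: "S \<subseteq> H - {x}" "card S = k - 1" "finite S"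
    using obtain_subset_with_card_n by metis
  then have "card (insert x S) = k" using assms(3) by (subst card_insert_disjoint) auto
  then have "insert x S \<in> nsets H k" using S fin assms(1) by (auto simp: nsets_def)
  then show thesis using that by blast
qed

text \<open>All vertices of the clique lie on built edges, and these stay inside
  \<open>{1..r}\<close>. So revealing vertices alone never creates a clique.\<close>

lemma has_mono_clique_revealed:
  assumes "has_mono_clique k ts (Position r' B)" "0 < k" "\<forall>t\<in>set ts. k \<le> t"
    and "\<forall>(e, c)\<in>set B. e \<subseteq> {1..r}"
  shows "has_mono_clique k ts (Position r B)"
proof -
  obtain c H where c: "c < length ts" and H: "H \<in> nsets {1..r'} (ts ! c)"
    and e: "\<forall>e\<in>nsets H k. (e, c) \<in> set B"
    using assms(1) by (auto simp: has_mono_clique_def)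
  have "H \<subseteq> {1..r}"
  proof
    fix x assume "x \<in> H"
    then obtain e where "x \<in> e" "e \<in> nsets H k"
      using in_mono_cliqueE[OF _ H] assms(2,3) c by (metis nth_mem)
    then show "x \<in> {1..r}" using e assms(4) by fastforce
  qed
  then have "H \<in> nsets {1..r} (ts ! c)" using H by (auto simp: nsets_def)
  then show ?thesis using c e by (auto simp: has_mono_clique_def)
qed

section \<open>The game tree of a forcing strategy\<close>

text \<open>
  The position in which vertex \<open>j\<close> was revealed on the way to \<open>q\<close>: an edge is built in the round
  of its largest vertex.
\<close>

definition before :: "position \<Rightarrow> nat \<Rightarrow> position" where
  "before q j = Position (j - 1) (filter (\<lambda>(e, c). Max e < j) (built q))"

lemma before_Position_built: "before (Position r (built q)) j = before q j"
  by (simp add: before_def)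

lemma before_before: "i \<le> j \<Longrightarrow> before (before q j) i = before q i"
  by (auto simp: before_def intro!: filter_cong)

text \<open>Reading the colours off a fixed sequence makes every branch of the game tree part of the
  play against one painter.\<close>

definition oblivious :: "(nat \<Rightarrow> nat) \<Rightarrow> painter" where
  "oblivious f p e = f (length (built p))"

text \<open>The given strategy \<beta> and its edge bound \<open>m\<close> belong to the game of
  uniformity \<open>k\<close>; the game to be won has uniformity \<open>k + 1\<close>. So
  \<open>k\<close> is one less here than in the theorem.\<close>

locale forcing_builder =
  fixes k :: nat and ts :: "nat list" and \<beta> :: builder and m :: nat
  assumes k_pos: "0 < k" and ts_nonempty: "ts \<noteq> []" and k_le: "\<forall>t\<in>set ts. k \<le> t"
    and forces: "builder_forces k ts \<beta> (\<lambda>p. length (built p) \<le> m)"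
begin

text \<open>The nodes of the game tree of \<beta>, cut off at the first monochromatic
  clique.\<close>

inductive reach :: "position \<Rightarrow> bool" where
  start: "reach (Position 0 [])"
| step: "reach q \<Longrightarrow> \<not> has_mono_clique k ts q \<Longrightarrow> c < length ts \<Longrightarrow>
     reach (make_move (\<lambda>_ _. c) q (\<beta> q))"

lemma reach_colours: "reach q \<Longrightarrow> (e, c) \<in> set (built q) \<Longrightarrow> c < length ts"
proof (induction arbitrary: e c rule: reach.induct)
  case (step q d)
  then show ?case by (cases "\<beta> q") auto
qed simp

text \<open>Each move either reveals one vertex or builds one edge, so the time at which
  \<open>q\<close> occurs can be read off from \<open>q\<close>.\<close>

lemma play_oblivious_reach:
  assumes "reach q" "\<forall>i<length (built q). f i = snd (built q ! i)"
  shows "play \<beta> (oblivious f) (revealed q + length (built q)) = q \<and>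
    (\<forall>j < revealed q + length (built q). \<not> has_mono_clique k ts (play \<beta> (oblivious f) j))"
  using assms
proof (induction rule: reach.induct)
  case (step q c)
  show ?case
  proof (cases "\<beta> q")
    case Reveal
    then show ?thesis using step by (auto simp: less_Suc_eq)
  next
    case (Build e)
    have "\<forall>i<length (built q). f i = snd (built q ! i)"
      using step.prems Build by (auto simp: nth_append less_Suc_eq)
    moreover have "f (length (built q)) = c"
      using step.prems Build by (auto simp: nth_append)
    ultimately show ?thesis using step Build by (auto simp: less_Suc_eq oblivious_def)
  qed
qed simp

text \<open>Against the painter that repeats the colours of \<open>q\<close> and then always answers
  \<open>0\<close>, the play passes through \<open>q\<close> no later than it wins. This transfers
  the guarantees of \<open>forces\<close> to every node.\<close>

lemma reach_future:
  assumes "reach q"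
  obtains r' B' where "has_mono_clique k ts (Position r' (built q @ B'))"
    "length (built q @ B') \<le> m"
    "\<not> has_mono_clique k ts q \<Longrightarrow> legal_move k q (\<beta> q)"
proof -
  define f where "f i = (if i < length (built q) then snd (built q ! i) else 0)" for i
  have "snd (built q ! i) < length ts" if "i < length (built q)" for i
    using reach_colours[OF assms] nth_mem[OF that] by (metis prod.collapse)
  then have "painter_strategy ts (oblivious f)"
    using ts_nonempty by (auto simp: painter_strategy_def oblivious_def f_def)
  then obtain n where n: "\<forall>j<n. legal_move k (play \<beta> (oblivious f) j) (\<beta> (play \<beta> (oblivious f) j))"
    "has_mono_clique k ts (play \<beta> (oblivious f) n)" "length (built (play \<beta> (oblivious f) n)) \<le> m"
    using forces unfolding builder_forces_def by blast
  define l where "l = revealed q + length (built q)"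
  have l: "play \<beta> (oblivious f) l = q" "\<forall>j<l. \<not> has_mono_clique k ts (play \<beta> (oblivious f) j)"
    using play_oblivious_reach[OF assms, of f] by (auto simp: f_def l_def)
  then have "l \<le> n" using n(2) by (meson not_le)
  then obtain B' where B': "built (play \<beta> (oblivious f) n) = built q @ B'"
    using built_play_mono[of l n \<beta> "oblivious f"] l by auto
  show thesis
  proof (rule that[of "revealed (play \<beta> (oblivious f) n)" B'])
    show "has_mono_clique k ts (Position (revealed (play \<beta> (oblivious f) n)) (built q @ B'))"
      using n(2) by (metis B' position.collapse)
    show "length (built q @ B') \<le> m" using n(3) B' by simp
    assume "\<not> has_mono_clique k ts q"
    then have "l < n" using \<open>l \<le> n\<close> n(2) l(1) le_neq_implies_less by metis
    then show "legal_move k q (\<beta> q)" using n(1) l(1) by metis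
  qed
qed

lemma reach_legal: "reach q \<Longrightarrow> \<not> has_mono_clique k ts q \<Longrightarrow> legal_move k q (\<beta> q)"
  by (metis reach_future)

lemma reach_length_le: "reach q \<Longrightarrow> length (built q) \<le> m"
  by (metis reach_future length_append le_add1 le_trans)

lemma reach_edges: "reach q \<Longrightarrow> (e, c) \<in> set (built q) \<Longrightarrow> e \<in> nsets {1..revealed q} k"
proof (induction arbitrary: e c rule: reach.induct)
  case (step q d)
  show ?case
  proof (cases "\<beta> q")
    case Reveal
    then have "e \<in> nsets {1..revealed q} k" using step by auto
    then show ?thesis using Reveal by (auto simp: nsets_def)
  next
    case (Build e')
    then show ?thesis using step reach_legal[OF step(1,2)] by auto
  qed
qed simp

text \<open>If no further edge were built after \<open>q\<close>, the final clique would already be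
  present at \<open>q\<close>. So at least one more edge must fit into the budget
  \<open>m\<close>.\<close>

lemma reach_length_less:
  assumes "reach q" "\<not> has_mono_clique k ts q"
  shows "length (built q) < m"
proof -
  obtain r' B' where 1: "has_mono_clique k ts (Position r' (built q @ B'))"
    "length (built q @ B') \<le> m" using reach_future assms by metis
  have "has_mono_clique k ts (Position (revealed q) (built q))" if "B' = []"
  proof (rule has_mono_clique_revealed[of _ _ r'])
    show "\<forall>(e, c)\<in>set (built q). e \<subseteq> {1..revealed q}"
      using reach_edges[OF assms(1)] unfolding nsets_def by blast
  qed (use 1 that k_pos k_le in auto)
  then show ?thesis using 1 assms(2) by (cases B') auto
qed

text \<open>Each of the rounds from \<open>k\<close> up to \<open>revealed q - 1\<close> contains an
  edge. The second conjunct also counts the current round, which carries the induction through a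
  reveal.\<close>

lemma reach_revealed_le:
  assumes "reach q"
  shows "revealed q \<le> k + length (built q) \<and>
    ((\<exists>(e, c)\<in>set (built q). revealed q \<in> e) \<longrightarrow> revealed q < k + length (built q))"
  using assms
proof (induction rule: reach.induct)
  case (step q d)
  note leg = reach_legal[OF step(1,2)]
  show ?case
  proof (cases "\<beta> q")
    case Reveal
    have "revealed q < k + length (built q)"
      using leg step.IH Reveal by auto
    moreover have "Suc (revealed q) \<notin> e" if "(e, c) \<in> set (built q)" for e c
      using reach_edges[OF step(1) that] by (auto simp: nsets_def)
    ultimately show ?thesis using Reveal by auto
  next
    case (Build e')
    then show ?thesis using step by auto
  qed
qed simp

text \<open>Equal colour sequences put both positions on one play with the same edge list. If one
  had more vertices revealed, its current round, numbered at least \<open>k\<close>, would contain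
  no edge, and revealing there would be illegal. This injectivity yields the bound on the number of
  vertices.\<close>

lemma reach_Reveal_inj:
  assumes "reach q" "reach q'" "\<not> has_mono_clique k ts q" "\<not> has_mono_clique k ts q'"
    and "\<beta> q = Reveal" "\<beta> q' = Reveal"
    and "k - 1 \<le> revealed q" "k - 1 \<le> revealed q'"
    and cols: "map snd (built q) = map snd (built q')"
  shows "q = q'"
proof -
  \<comment> \<open>By symmetry, \<open>x\<close> may be taken to have at most as many revealed
    vertices as \<open>y\<close>.\<close>
  have *: "x = y" if "reach x" "reach y" "\<not> has_mono_clique k ts y"
    and "\<beta> y = Reveal" and "k - 1 \<le> revealed x" and "map snd (built x) = map snd (built y)"
    and le: "revealed x \<le> revealed y" for x y
  proof -
    define f where "f i = (if i < length (built x) then snd (built x ! i) else 0)" for i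
    have len: "length (built x) = length (built y)" using that by (metis length_map)
    have "snd (built x ! i) = snd (built y ! i)" if "i < length (built x)" for i
      using that len \<open>map snd (built x) = map snd (built y)\<close> by (metis nth_map)
    then have p: "play \<beta> (oblivious f) (revealed x + length (built x)) = x"
      "play \<beta> (oblivious f) (revealed y + length (built y)) = y"
      using play_oblivious_reach[OF that(1), of f] play_oblivious_reach[OF that(2), of f] len
      by (auto simp: f_def)
    obtain B where "built y = built x @ B"
      using built_play_mono[of "revealed x + length (built x)" "revealed y + length (built y)" \<beta> "oblivious f"]
        p len le by auto
    then have bu: "built y = built x" using len by simp
    have "revealed x = revealed y"
    proof (rule ccontr)
      assume "revealed x \<noteq> revealed y"
      then have lt: "revealed x < revealed y" using le by simp
      have "legal_move k y Reveal" using reach_legal that by metis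
      moreover have "\<not> revealed y < k" using lt that(5) by simp
      ultimately obtain e c where "(e, c) \<in> set (built x)" "revealed y \<in> e" using bu by auto
      then show False using reach_edges[OF that(1)] lt by (fastforce simp: nsets_def)
    qed
    then show ?thesis using bu by (metis position.collapse)
  qed
  show ?thesis
  proof (cases "revealed q \<le> revealed q'")
    case True
    then show ?thesis using * assms by simp
  next
    case False
    then show ?thesis using *[of q' q] assms by simp
  qed
qed

text \<open>The new edge belongs to the current round and is filtered out. Hence building leaves the
  labels of the revealed vertices unchanged.\<close>

lemma before_Build:
  assumes "finite e" "revealed q \<in> e" "j \<le> revealed q"
  shows "before (Position (revealed q) (built q @ [(e, c)])) j = before q j"
proof -
  have "revealed q \<le> Max e" using assms by simp
  then show ?thesis using assms(3) by (auto simp: before_def)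
qed

text \<open>Thus the vertex revealed at \<open>q\<close> is played by the occupant of
  \<open>q\<close> itself.\<close>

lemma before_Reveal:
  assumes "reach q"
  shows "before q (Suc (revealed q)) = q"
proof -
  have "Max e < Suc (revealed q)" if "(e, c) \<in> set (built q)" for e c
  proof -
    have "e \<in> nsets {1..revealed q} k" using reach_edges[OF assms that] .
    moreover from this have "e \<noteq> {}" using k_pos by (auto simp: nsets_def)
    ultimately show ?thesis by (auto simp: nsets_def less_Suc_eq_le)
  qed
  then have "filter (\<lambda>(e, c). Max e < Suc (revealed q)) (built q) = built q"
    by (auto simp: filter_id_conv)
  then show ?thesis by (simp add: before_def)
qed

lemma no_clique_empty: "\<not> has_mono_clique k ts (Position r [])"
proof
  assume "has_mono_clique k ts (Position r [])"
  then obtain c H where c: "c < length ts" "H \<in> nsets {1..r} (ts ! c)" "nsets H k = {}"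
    by (auto simp: has_mono_clique_def)
  have kc: "k \<le> ts ! c" using k_le c(1) by simp
  then have "H \<noteq> {}" using c(2) k_pos by (auto simp: nsets_def)
  then obtain x where "x \<in> H" by blast
  then show False using in_mono_cliqueE[OF _ c(2) k_pos kc] c(3) by blast
qed

text \<open>Fewer than \<open>k\<close> vertices carry no edge, so \<beta> can only reveal, and the
  tree begins with an unbranched path.\<close>

lemma reach_initial: "j \<le> k \<Longrightarrow> reach (Position j [])"
  and Reveal_initial: "j < k \<Longrightarrow> \<beta> (Position j []) = Reveal"
proof -
  have R: "\<beta> (Position j []) = Reveal" if "reach (Position j [])" "j < k" for j
  proof -
    have "legal_move k (Position j []) (\<beta> (Position j []))"
      by (rule reach_legal[OF that(1) no_clique_empty])
    moreover have "\<not> legal_move k (Position j []) (Build e)" for e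
    proof
      assume "legal_move k (Position j []) (Build e)"
      then have "e \<subseteq> {1..j}" "card e = k" by (auto simp: nsets_def)
      then have "k \<le> card {1..j}" by (metis card_mono finite_atLeastAtMost)
      then show False using that(2) by simp
    qed
    ultimately show ?thesis by (cases "\<beta> (Position j [])") auto
  qed
  show r: "reach (Position j [])" if "j \<le> k" for j
    using that
  proof (induction j)
    case (Suc j)
    have "reach (make_move (\<lambda>_ _. 0) (Position j []) (\<beta> (Position j [])))"
      using Suc ts_nonempty no_clique_empty by (intro step) auto
    then show ?case using R[of j] Suc by simp
  qed (rule start)
  show "j < k \<Longrightarrow> \<beta> (Position j []) = Reveal" by (intro R r) auto
qed

section \<open>The tree of occupied nodes\<close>

text \<open>
  \<open>\<Lambda>\<close> maps an occupied node, that is, a position of the \<open>k\<close>-uniform game at which \<open>\<beta>\<close> reveals,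
  to its occupant in the \<open>(k + 1)\<close>-uniform game; \<open>label \<Lambda> x j\<close> is the occupant that plays the part
  of vertex \<open>j\<close> at \<open>x\<close>.  In \<open>tree_inv\<close>, \<open>D\<close> is the set of occupied nodes, and the newest
  vertex \<open>revealed p\<close> has walked to \<open>q\<close>.
\<close>

definition label :: "(position \<Rightarrow> nat) \<Rightarrow> position \<Rightarrow> nat \<Rightarrow> nat" where
  "label \<Lambda> x j = \<Lambda> (before x j)"

definition traced :: "(position \<Rightarrow> nat) \<Rightarrow> (nat set \<times> nat) list \<Rightarrow> position \<Rightarrow> nat \<Rightarrow> bool" where
  "traced \<Lambda> B x u \<longleftrightarrow> (\<forall>(e, c)\<in>set (built x). (insert u (label \<Lambda> x ` e), c) \<in> set B)"

definition tree_inv :: "position set \<Rightarrow> (position \<Rightarrow> nat) \<Rightarrow> position \<Rightarrow> position \<Rightarrow> bool" where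
  "tree_inv D \<Lambda> q p \<longleftrightarrow>
     finite D \<and> bij_betw \<Lambda> D {1..<revealed p} \<and> (\<lambda>j. Position j []) ` {..<k} \<subseteq> D \<and>
     reach q \<and> k \<le> revealed q \<and> k < revealed p \<and>
     (\<forall>x\<in>D. reach x \<and> \<not> has_mono_clique k ts x \<and> \<beta> x = Reveal \<and> traced \<Lambda> (built p) x (\<Lambda> x)) \<and>
     traced \<Lambda> (built p) q (revealed p) \<and>
     (\<forall>x\<in>insert q D. \<forall>j\<in>{1..revealed x}. before x j \<in> D) \<and>
     (\<forall>(e, c)\<in>set (built p). e \<subseteq> {1..revealed p} \<and>
        (revealed p \<in> e \<longrightarrow>
          e \<in> (\<lambda>e'. insert (revealed p) (label \<Lambda> q ` e')) ` fst ` set (built q))) \<and>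
     length (built p) \<le> m * (revealed p - 1 - k) + length (built q)"

lemma label_cong:
  assumes "\<And>j. 1 \<le> j \<Longrightarrow> j \<le> revealed x \<Longrightarrow> label \<Lambda> x j = label \<Lambda>' x' j" "e \<in> nsets {1..revealed x} k"
  shows "label \<Lambda> x ` e = label \<Lambda>' x' ` e"
  using assms by (intro image_cong) (auto simp: nsets_def)

lemma traced_cong:
  assumes "traced \<Lambda> B x u" "reach x"
    "\<And>j. 1 \<le> j \<Longrightarrow> j \<le> revealed x \<Longrightarrow> label \<Lambda> x j = label \<Lambda>' x j" "set B \<subseteq> set B'"
  shows "traced \<Lambda>' B' x u"
  unfolding traced_def
proof clarify
  fix e c assume ec: "(e, c) \<in> set (built x)"
  have "label \<Lambda> x ` e = label \<Lambda>' x ` e"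
    by (rule label_cong[OF assms(3) reach_edges[OF assms(2) ec]])
  then show "(insert u (label \<Lambda>' x ` e), c) \<in> set B'"
    using assms(1,4) ec by (fastforce simp: traced_def)
qed

text \<open>The node \<open>before x j\<close> has \<open>j - 1\<close> revealed vertices, so
  distinct \<open>j\<close> give distinct nodes, and \<Lambda> is injective on \<open>D\<close>.
  Consequently a relabelled edge keeps its size and avoids the current vertex.\<close>

lemma tree_inv_label:
  assumes "tree_inv D \<Lambda> q p" "x \<in> insert q D"
  shows "inj_on (label \<Lambda> x) {1..revealed x}" "label \<Lambda> x ` {1..revealed x} \<subseteq> {1..<revealed p}"
proof -
  have b: "before x j \<in> D" if "j \<in> {1..revealed x}" for j
    using assms that by (auto simp: tree_inv_def)
  have bij: "bij_betw \<Lambda> D {1..<revealed p}" using assms by (simp add: tree_inv_def)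
  show "label \<Lambda> x ` {1..revealed x} \<subseteq> {1..<revealed p}"
    using b bij_betwE[OF bij] by (auto simp: label_def)
  show "inj_on (label \<Lambda> x) {1..revealed x}"
  proof (rule inj_onI)
    fix i j assume ij: "i \<in> {1..revealed x}" "j \<in> {1..revealed x}" "label \<Lambda> x i = label \<Lambda> x j"
    then have "before x i = before x j"
      using b bij by (metis bij_betw_imp_inj_on inj_onD label_def)
    then have "i - 1 = j - 1" by (simp add: before_def)
    then show "i = j" using ij by auto
  qed
qed

section \<open>Counting vertices and edges\<close>

definition vertex_bound :: nat where
  "vertex_bound = (\<Sum>i<m. length ts ^ i)"

text \<open>All vertices but the current one occupy nodes. Nodes with at least \<open>k - 1\<close>
  revealed vertices inject into the colour sequences of length less than \<open>m\<close>, of which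
  there are \<open>vertex_bound\<close>; the remaining ones are among \<open>k - 1\<close> empty
  positions.\<close>

lemma tree_inv_revealed_le:
  assumes "tree_inv D \<Lambda> q p"
  shows "revealed p \<le> k + vertex_bound"
proof -
  define X where "X = {x \<in> D. k - 1 \<le> revealed x}"
  define C where "C = {cs. set cs \<subseteq> {..<length ts} \<and> length cs < m}"
  have fin: "finite D" and bij: "bij_betw \<Lambda> D {1..<revealed p}" and r: "k < revealed p"
    and D: "\<forall>x\<in>D. reach x \<and> \<not> has_mono_clique k ts x \<and> \<beta> x = Reveal"
    using assms by (auto simp: tree_inv_def)
  have "C = (\<Union>i\<in>{..<m}. {cs. set cs \<subseteq> {..<length ts} \<and> length cs = i})"
    by (auto simp: C_def)
  also have "card \<dots> = (\<Sum>i<m. card {cs. set cs \<subseteq> {..<length ts} \<and> length cs = i})"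
    by (rule card_UN_disjoint) (auto simp: finite_lists_length_eq)
  finally have C: "card C = vertex_bound"
    by (simp add: vertex_bound_def card_lists_length_eq)
  have finC: "finite C"
    unfolding C_def by (rule finite_subset[OF _ finite_lists_length_le[of "{..<length ts}" m]]) auto
  have "card X \<le> card C"
  proof (rule card_inj_on_le)
    show "inj_on (\<lambda>x. map snd (built x)) X"
      using D by (auto intro!: inj_onI reach_Reveal_inj simp: X_def)
    show "(\<lambda>x. map snd (built x)) ` X \<subseteq> C"
      using D reach_colours reach_length_less unfolding X_def C_def by fastforce
  qed (rule finC)
  moreover have "card (D - X) \<le> k - 1"
  proof -
    have "D - X \<subseteq> (\<lambda>j. Position j []) ` {..<k - 1}"
    proof
      fix x assume x: "x \<in> D - X"
      then have less: "revealed x < k - 1" by (auto simp: X_def)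
      have "(e, c) \<notin> set (built x)" for e c
      proof
        assume "(e, c) \<in> set (built x)"
        then have "e \<in> nsets {1..revealed x} k" using D x reach_edges by blast
        then have "k \<le> card {1..revealed x}"
          unfolding nsets_def by (metis (mono_tags, lifting) card_mono finite_atLeastAtMost mem_Collect_eq)
        then show False using less by simp
      qed
      then have "built x = []" by (metis list.set_intros(1) neq_Nil_conv surj_pair)
      then have "x = Position (revealed x) []" by (metis position.collapse)
      then show "x \<in> (\<lambda>j. Position j []) ` {..<k - 1}" using less by blast
    qed
    then have "card (D - X) \<le> card ((\<lambda>j. Position j []) ` {..<k - 1})" by (intro card_mono) auto
    also have "\<dots> \<le> k - 1" using card_image_le[of "{..<k - 1}" "\<lambda>j. Position j []"] by simp
    finally show ?thesis .
  qed
  moreover have "card D = card (D - X) + card X"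
    using fin by (subst card_Diff_subset) (auto simp: X_def card_mono)
  moreover have "card D = revealed p - 1" using bij_betw_same_card[OF bij] by simp
  ultimately show ?thesis using C r k_pos by linarith
qed

text \<open>The first \<open>k\<close> vertices cost nothing, and each later one, the current one
  included, is charged at most \<open>m\<close> edges.\<close>

lemma tree_inv_built_le:
  assumes "tree_inv D \<Lambda> q p"
  shows "length (built p) \<le> m * vertex_bound"
proof -
  have "length (built q) \<le> m" "k < revealed p"
    "length (built p) \<le> m * (revealed p - 1 - k) + length (built q)"
    using assms reach_length_le by (auto simp: tree_inv_def)
  then have "length (built p) \<le> m * (revealed p - 1 - k) + m * 1" by simp
  also have "\<dots> = m * (revealed p - k)"
    unfolding add_mult_distrib2[symmetric] using \<open>k < revealed p\<close>
    by (intro arg_cong[of _ _ "(*) m"]) linarith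
  also have "\<dots> \<le> m * vertex_bound"
    using tree_inv_revealed_le[OF assms] by (intro mult_le_mono2) simp
  finally show ?thesis .
qed

section \<open>Cliques and moves in the tree\<close>

text \<open>The clique consists of the occupants that play the vertices of \<open>H\<close>,
  together with the current vertex. Edges through the current vertex copy edges of \<open>q\<close>;
  the others copy edges seen on the walks of earlier occupants.\<close>

lemma tree_inv_clique:
  assumes inv: "tree_inv D \<Lambda> q p" and cl: "has_mono_clique k ts q"
  shows "has_mono_clique (Suc k) (map Suc ts) p"
proof -
  obtain c H where c: "c < length ts" and H: "H \<in> nsets {1..revealed q} (ts ! c)"
    and e: "\<forall>e\<in>nsets H k. (e, c) \<in> set (built q)"
    using cl by (auto simp: has_mono_clique_def)
  let ?l = "label \<Lambda> q" and ?r = "revealed p"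
  note lab = tree_inv_label[OF inv, of q, simplified]
  have HS: "H \<subseteq> {1..revealed q}" "finite H" "card H = ts ! c" using H by (auto simp: nsets_def)
  have inj: "inj_on ?l H" using lab(1) HS(1) by (auto intro: inj_on_subset)
  have lH: "?l ` H \<subseteq> {1..<?r}" using lab(2) HS(1) by auto
  have r: "k < ?r" using inv by (simp add: tree_inv_def)
  have "card (insert ?r (?l ` H)) = Suc (ts ! c)"
    using lH HS inj by (subst card_insert_disjoint) (auto simp: card_image)
  then have "insert ?r (?l ` H) \<in> nsets {1..?r} (map Suc ts ! c)"
    using lH HS r c by (auto simp: nsets_def)
  moreover have "(g, c) \<in> set (built p)" if g: "g \<in> nsets (insert ?r (?l ` H)) (Suc k)" for g
  proof (cases "?r \<in> g")
    case True
    then have "g - {?r} \<subseteq> ?l ` H" using g by (auto simp: nsets_def)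
    then obtain d where d: "d \<subseteq> H" "g - {?r} = ?l ` d" by (auto simp: subset_image_iff)
    have "card (g - {?r}) = k" using g True by (auto simp: nsets_def)
    then have "card d = k" using d inj by (metis card_image inj_on_subset)
    then have "(d, c) \<in> set (built q)" using e d finite_subset[OF d(1) HS(2)] by (auto simp: nsets_def)
    then have "(insert ?r (?l ` d), c) \<in> set (built p)"
      using inv by (auto simp: tree_inv_def traced_def)
    then show ?thesis using d True by (metis insert_Diff)
  next
    case False
    then have "g \<subseteq> ?l ` H" using g by (auto simp: nsets_def)
    then obtain d where d: "d \<subseteq> H" "g = ?l ` d" by (auto simp: subset_image_iff)
    have fd: "finite d" using d HS finite_subset by blast
    have "card d = Suc k" using d g inj by (metis (mono_tags, lifting) card_image inj_on_subset mem_Collect_eq nsets_def)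
    then have "d \<noteq> {}" by auto
    \<comment> \<open>The occupant that plays \<open>j\<close> walked to \<open>before q j\<close>,
      where the edge \<open>d - {j}\<close> is already present with colour \<open>c\<close>. The
      trace of that walk therefore contains the required edge.\<close>
    define j where "j = Max d"
    have j: "j \<in> d" using \<open>d \<noteq> {}\<close> fd by (simp add: j_def)
    have dj: "i < j" if "i \<in> d - {j}" for i
      using that fd by (metis DiffE Max_ge insertI1 j_def le_neq_implies_less)
    have "d - {j} \<in> nsets H k" using d HS fd j \<open>card d = Suc k\<close> by (auto simp: nsets_def)
    moreover have "d - {j} \<noteq> {}" using \<open>card d = Suc k\<close> k_pos j fd
      by (metis card.empty card_Diff_singleton diff_Suc_1 less_irrefl)
    then have "Max (d - {j}) < j" using dj fd by simp
    ultimately have in_b: "(d - {j}, c) \<in> set (built (before q j))"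
      using e by (auto simp: before_def)
    have jr: "j \<in> {1..revealed q}" using j d HS by auto
    then have bD: "before q j \<in> D" using inv by (auto simp: tree_inv_def)
    then have "(insert (\<Lambda> (before q j)) (label \<Lambda> (before q j) ` (d - {j})), c) \<in> set (built p)"
      using inv in_b by (fastforce simp: tree_inv_def traced_def)
    moreover have "label \<Lambda> (before q j) ` (d - {j}) = ?l ` (d - {j})"
      using dj by (intro image_cong refl) (simp add: label_def before_before less_imp_le)
    moreover have "\<Lambda> (before q j) = ?l j" by (simp add: label_def)
    ultimately have "(insert (?l j) (?l ` (d - {j})), c) \<in> set (built p)" by simp
    then show ?thesis using d j by (metis image_insert insert_Diff)
  qed
  ultimately show ?thesis unfolding has_mono_clique_def
    using c by (intro exI[of _ c] conjI bexI[of _ "insert ?r (?l ` H)"] ballI) simp_all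
qed

text \<open>The older occupant of \<open>q\<close> takes the part of the vertex that \<beta>
  reveals. Only the node advances; \<open>p\<close> stays the same.\<close>

lemma tree_inv_pass:
  assumes inv: "tree_inv D \<Lambda> q p" and "\<not> has_mono_clique k ts q" and R: "\<beta> q = Reveal" and "q \<in> D"
  shows "tree_inv D \<Lambda> (Position (Suc (revealed q)) (built q)) p"
proof -
  let ?q = "Position (Suc (revealed q)) (built q)"
  have q: "reach q" using inv by (simp add: tree_inv_def)
  \<comment> \<open>A reveal ignores the colour, so \<open>0\<close> serves as an arbitrary
    one.\<close>
  have "reach (make_move (\<lambda>_ _. 0) q (\<beta> q))"
    using q assms(2) ts_nonempty by (intro step) auto
  then have "reach ?q" using R by simp
  moreover have lab: "label \<Lambda> ?q = label \<Lambda> q" by (simp add: fun_eq_iff label_def before_Position_built)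
  moreover have "before ?q j \<in> D" if "j \<in> {1..Suc (revealed q)}" for j
  proof (cases "j = Suc (revealed q)")
    case True
    then show ?thesis using before_Reveal[OF q] assms(4) by (simp add: before_Position_built)
  next
    case False
    then have "j \<in> {1..revealed q}" using that by auto
    then show ?thesis using inv by (auto simp: tree_inv_def before_Position_built)
  qed
  ultimately show ?thesis using inv
    unfolding tree_inv_def traced_def by auto
qed

text \<open>The current vertex occupies \<open>q\<close>, and the next one starts below the occupied
  initial path. Since \<beta> legally reveals at \<open>q\<close> in a round at least
  \<open>k\<close>, that round has an edge, and its copy contains the current vertex; this makes the
  reveal in the larger game legal.\<close>

lemma tree_inv_attach:
  assumes inv: "tree_inv D \<Lambda> q p" and nc: "\<not> has_mono_clique k ts q" and R: "\<beta> q = Reveal" and "q \<notin> D"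
  shows "legal_move (Suc k) p Reveal"
    and "tree_inv (insert q D) (\<Lambda>(q := revealed p)) (Position k []) (Position (Suc (revealed p)) (built p))"
proof -
  let ?r = "revealed p" and ?L = "\<Lambda>(q := revealed p)"
  have q: "reach q" "k \<le> revealed q" and tr: "traced \<Lambda> (built p) q ?r" and r: "k < ?r"
    and before: "\<And>x j. x \<in> insert q D \<Longrightarrow> j \<in> {1..revealed x} \<Longrightarrow> before x j \<in> D"
    and D: "\<And>x. x \<in> D \<Longrightarrow> reach x \<and> \<not> has_mono_clique k ts x \<and> \<beta> x = Reveal \<and> traced \<Lambda> (built p) x (\<Lambda> x)"
    and bij: "bij_betw \<Lambda> D {1..<?r}" and ini: "(\<lambda>j. Position j []) ` {..<k} \<subseteq> D"
    and len: "length (built p) \<le> m * (?r - 1 - k) + length (built q)"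
    and ed: "\<And>e c. (e, c) \<in> set (built p) \<Longrightarrow> e \<subseteq> {1..?r}"
    using inv unfolding tree_inv_def by blast+
  have "legal_move k q Reveal" using reach_legal[OF q(1) nc] R by simp
  then obtain e c where "(e, c) \<in> set (built q)" using q(2) by auto
  then have "(insert ?r (label \<Lambda> q ` e), c) \<in> set (built p)" using tr by (auto simp: traced_def)
  then show "legal_move (Suc k) p Reveal" by auto
  \<comment> \<open>Labels are read off at nodes of \<open>D\<close> only, so redefining \<Lambda>
    at \<open>q\<close> changes none of them.\<close>
  have lab: "label \<Lambda> x j = label ?L x j" if "x \<in> insert q D" "1 \<le> j" "j \<le> revealed x" for x j
    using before[of x j] that assms(4) by (auto simp: label_def)
  have T: "traced ?L (built p) x (?L x)" if "x \<in> insert q D" for x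
  proof (rule traced_cong[where \<Lambda> = \<Lambda>])
    show "traced \<Lambda> (built p) x (?L x)" "reach x" using that tr D q(1) assms(4) by auto
  qed (use lab that in auto)
  have "bij_betw ?L D {1..<?r}"
    using bij assms(4) by (subst bij_betw_cong[of _ _ \<Lambda>]) auto
  then have "bij_betw ?L (D \<union> {q}) ({1..<?r} \<union> {?r})"
    by (rule bij_betw_combine) (auto simp: bij_betw_def)
  moreover have "{1..<?r} \<union> {?r} = {1..<Suc ?r}" using r by auto
  ultimately have "bij_betw ?L (insert q D) {1..<Suc ?r}" by simp
  moreover have "before (Position k []) j \<in> D" if "j \<in> {1..k}" for j
    using ini that by (auto simp: before_def)
  moreover have "length (built p) \<le> m * (?r - k)"
  proof -
    have "length (built p) \<le> m * (?r - 1 - k) + m * 1" using len reach_length_le[OF q(1)] by simp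
    also have "\<dots> = m * (?r - k)"
      unfolding add_mult_distrib2[symmetric] using r by (intro arg_cong[of _ _ "(*) m"]) linarith
    finally show ?thesis .
  qed
  moreover have "e \<subseteq> {1..Suc ?r} \<and> Suc ?r \<notin> e" if "(e, c) \<in> set (built p)" for e c
    using ed[OF that] by force
  moreover have "finite D" using inv by (simp add: tree_inv_def)
  moreover have "traced ?L (built p) (Position k []) (Suc ?r)" by (simp add: traced_def)
  moreover have "\<forall>x\<in>insert (Position k []) (insert q D). \<forall>j\<in>{1..revealed x}. before x j \<in> insert q D"
    using before \<open>\<And>j. j \<in> {1..k} \<Longrightarrow> before (Position k []) j \<in> D\<close> by fastforce
  moreover have "\<forall>x\<in>insert q D. reach x \<and> \<not> has_mono_clique k ts x \<and> \<beta> x = Reveal \<and> traced ?L (built p) x (?L x)"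
    using T D q(1) nc R by (metis insert_iff)
  moreover have "(\<lambda>j. Position j []) ` {..<k} \<subseteq> insert q D" using ini by blast
  ultimately show "tree_inv (insert q D) ?L (Position k []) (Position (Suc ?r) (built p))"
    unfolding tree_inv_def position.sel using reach_initial[of k] r by fastforce
qed

text \<open>Every earlier edge through the current vertex copies an edge \<open>e'\<close> of
  \<open>q\<close>. As labels are injective, \<open>g\<close> could coincide with it only if
  \<open>e' = e\<close>, against the legality of \<open>e\<close>.\<close>

lemma tree_inv_build:
  assumes inv: "tree_inv D \<Lambda> q p" and nc: "\<not> has_mono_clique k ts q" and E: "\<beta> q = Build e"
  defines "g \<equiv> insert (revealed p) (label \<Lambda> q ` e)"
  shows "legal_move (Suc k) p (Build g)"
    and "c < length ts \<Longrightarrow>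
      tree_inv D \<Lambda> (Position (revealed q) (built q @ [(e, c)])) (Position (revealed p) (built p @ [(g, c)]))"
proof -
  let ?r = "revealed p" and ?l = "label \<Lambda> q"
  have q: "reach q" "k \<le> revealed q" and tr: "traced \<Lambda> (built p) q ?r" and r: "k < ?r"
    and before: "\<And>x j. x \<in> insert q D \<Longrightarrow> j \<in> {1..revealed x} \<Longrightarrow> before x j \<in> D"
    and D: "\<And>x. x \<in> D \<Longrightarrow> reach x \<and> \<not> has_mono_clique k ts x \<and> \<beta> x = Reveal \<and> traced \<Lambda> (built p) x (\<Lambda> x)"
    and bij: "bij_betw \<Lambda> D {1..<?r}" and ini: "(\<lambda>j. Position j []) ` {..<k} \<subseteq> D"
    and len: "length (built p) \<le> m * (?r - 1 - k) + length (built q)"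
    and ed: "\<And>d c. (d, c) \<in> set (built p) \<Longrightarrow> d \<subseteq> {1..?r}"
    and new: "\<And>d c. (d, c) \<in> set (built p) \<Longrightarrow> ?r \<in> d \<Longrightarrow> d \<in> (\<lambda>e'. insert ?r (?l ` e')) ` fst ` set (built q)"
    using inv unfolding tree_inv_def by blast+
  note lab = tree_inv_label[OF inv, of q, simplified]
  have "legal_move k q (Build e)" using reach_legal[OF q(1) nc] E by simp
  then have e: "e \<subseteq> {1..revealed q}" "finite e" "card e = k" "revealed q \<in> e" "e \<notin> fst ` set (built q)"
    by (auto simp: nsets_def)
  have inj: "inj_on ?l e" using lab(1) e(1) by (auto intro: inj_on_subset)
  have le: "?l ` e \<subseteq> {1..<?r}" using lab(2) e(1) by auto
  have "card g = Suc k"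
    unfolding g_def using le e inj by (subst card_insert_disjoint) (auto simp: card_image)
  then have gn: "g \<in> nsets {1..?r} (Suc k)"
    using le e(2) r unfolding g_def nsets_def by auto
  have "g \<notin> fst ` set (built p)"
  proof
    assume "g \<in> fst ` set (built p)"
    then obtain d where "(g, d) \<in> set (built p)" by auto
    moreover have "?r \<in> g" by (simp add: g_def)
    ultimately obtain e' d' where e': "(e', d') \<in> set (built q)" "g = insert ?r (?l ` e')"
      using new by fastforce
    have es: "e' \<subseteq> {1..revealed q}" using reach_edges[OF q(1) e'(1)] by (auto simp: nsets_def)
    then have "?l ` e' \<subseteq> {1..<?r}" using lab(2) by auto
    then have "?r \<notin> ?l ` e'" "?r \<notin> ?l ` e" using le by auto
    then have "?l ` e' = ?l ` e" using e'(2) unfolding g_def by (metis insert_ident)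
    then have "e' = e" using inj_on_image_eq_iff[OF lab(1)] es e(1) by auto
    then show False using e(5) e'(1) by force
  qed
  then show "legal_move (Suc k) p (Build g)" using gn by (simp add: g_def)
  assume c: "c < length ts"
  let ?q = "Position (revealed q) (built q @ [(e, c)])" and ?B = "built p @ [(g, c)]"
  have rq: "reach ?q" using step[OF q(1) nc c] E by simp
  have bq: "before ?q j = before q j" if "j \<in> {1..revealed q}" for j
    using before_Build[OF e(2,4)] that by simp
  have lq: "label \<Lambda> ?q ` d = ?l ` d" if "d \<subseteq> {1..revealed q}" for d
    using bq that by (intro image_cong refl) (auto simp: label_def)
  have sub: "d \<subseteq> {1..revealed q}" if "(d, d') \<in> set (built q)" for d d'
    using reach_edges[OF q(1) that] by (auto simp: nsets_def)
  have "traced \<Lambda> ?B ?q ?r"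
    unfolding traced_def
  proof clarify
    fix d d' assume "(d, d') \<in> set (built ?q)"
    then consider "(d, d') \<in> set (built q)" | "d = e" "d' = c" by auto
    then show "(insert ?r (label \<Lambda> ?q ` d), d') \<in> set ?B"
    proof cases
      case 1
      then show ?thesis using tr lq[OF sub[OF 1]] by (auto simp: traced_def)
    next
      case 2
      then show ?thesis using lq[OF e(1)] by (simp add: g_def)
    qed
  qed
  moreover have "\<forall>x\<in>D. reach x \<and> \<not> has_mono_clique k ts x \<and> \<beta> x = Reveal \<and> traced \<Lambda> ?B x (\<Lambda> x)"
    using D by (fastforce simp: traced_def)
  moreover have "before ?q j \<in> D" if "j \<in> {1..revealed ?q}" for j
    using before[of q j] bq[of j] that by simp
  then have "\<forall>x\<in>insert ?q D. \<forall>j\<in>{1..revealed x}. before x j \<in> D"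
    using before by blast
  moreover have "\<forall>(d, d')\<in>set ?B. d \<subseteq> {1..?r} \<and>
    (?r \<in> d \<longrightarrow> d \<in> (\<lambda>e'. insert ?r (label \<Lambda> ?q ` e')) ` fst ` set (built ?q))"
  proof clarify
    fix d d' assume d: "(d, d') \<in> set ?B"
  show "d \<subseteq> {1..?r} \<and> (?r \<in> d \<longrightarrow> d \<in> (\<lambda>e'. insert ?r (label \<Lambda> ?q ` e')) ` fst ` set (built ?q))"
    proof (cases "(d, d') \<in> set (built p)")
      case True
      have "d \<in> (\<lambda>e'. insert ?r (label \<Lambda> ?q ` e')) ` fst ` set (built ?q)" if rd: "?r \<in> d"
      proof -
        obtain e' f where f: "(e', f) \<in> set (built q)" "d = insert ?r (?l ` e')"
          using new[OF True rd] by auto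
        then have "d = insert ?r (label \<Lambda> ?q ` e')" using lq[OF sub[OF f(1)]] by simp
        moreover have "e' \<in> fst ` set (built ?q)" using f(1) by force
        ultimately show ?thesis by blast
      qed
      then show ?thesis using ed[OF True] by blast
    next
      case False
      then have "d = g" using d by simp
      moreover have "g = insert ?r (label \<Lambda> ?q ` e)" using lq[OF e(1)] by (simp add: g_def)
      moreover have "g \<subseteq> {1..?r}" using gn by (simp add: nsets_def)
      ultimately show ?thesis by auto
    qed
  qed
  moreover have "finite D" using inv by (simp add: tree_inv_def)
  moreover have "length ?B \<le> m * (?r - 1 - k) + length (built ?q)" using len by simp
  ultimately show "tree_inv D \<Lambda> ?q (Position ?r ?B)"
    unfolding tree_inv_def position.sel using rq q(2) r bij ini
    by - (intro conjI; assumption)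
qed

section \<open>Winning the game of uniformity \<open>k + 1\<close>\<close>

text \<open>Vertex \<open>j + 1\<close> occupies the \<open>j\<close>-th node of the initial path
  for \<open>j < k\<close>, without any edge; vertex \<open>k + 1\<close> is the first to
  walk.\<close>

lemma tree_inv_initial:
  "tree_inv ((\<lambda>j. Position j []) ` {..<k}) (\<lambda>x. Suc (revealed x)) (Position k []) (Position (Suc k) [])"
proof -
  have "bij_betw (\<lambda>x. Suc (revealed x)) ((\<lambda>j. Position j []) ` {..<k}) {1..<Suc k}"
    by (rule bij_betw_byWitness[of _ "\<lambda>i. Position (i - 1) []"]) auto
  then show ?thesis
    unfolding tree_inv_def
    using reach_initial Reveal_initial no_clique_empty by (auto simp: traced_def before_def)
qed

text \<open>The move bound encodes a lexicographic measure: the vertices still available, then what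
  remains of the current walk. A walk has \<open>revealed q + length (built q)\<close> at most
  \<open>2 * m + k\<close>, and the factor \<open>2 * m + k + 2\<close> exceeds the second
  component, so starting a new walk still lowers the total.\<close>

lemma wins_if_tree_inv:
  assumes "tree_inv D \<Lambda> q p"
  shows "wins (Suc k) (map Suc ts)
    (\<lambda>p. revealed p \<le> k + vertex_bound \<and> length (built p) \<le> m * vertex_bound)
    ((k + vertex_bound - revealed p) * (2 * m + k + 2) + (2 * m + k - (revealed q + length (built q)))) p"
    (is "wins _ _ ?P (?meas q p) p")
  using assms
proof (induction "?meas q p" arbitrary: D \<Lambda> q p rule: less_induct)
  case less
  let ?wins = "wins (Suc k) (map Suc ts) ?P"
  note inv = less.prems
  have P: "?P p" using tree_inv_revealed_le[OF inv] tree_inv_built_le[OF inv] by simp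
  show ?case
  proof (cases "has_mono_clique k ts q")
    case True
    then have "?wins 0 p" using P tree_inv_clique[OF inv] by simp
    then show ?thesis by (rule wins_mono) simp
  next
    case nc: False
    have q: "reach q" using inv by (simp add: tree_inv_def)
    have lq: "length (built q) < m" by (rule reach_length_less[OF q nc])
    show ?thesis
    proof (cases "\<beta> q")
      case R: Reveal
      show ?thesis
      proof (cases "q \<in> D")
        case True
        let ?q = "Position (Suc (revealed q)) (built q)"
        have inv': "tree_inv D \<Lambda> ?q p" by (rule tree_inv_pass[OF inv nc R True])
        then have "reach ?q" by (simp add: tree_inv_def)
        then have "Suc (revealed q) \<le> k + length (built q)"
          using reach_revealed_le by fastforce
        then have less': "?meas ?q p < ?meas q p" using lq by simp
        \<comment> \<open>Passing makes no move in the larger game; the measure drops only to drive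
          the induction.\<close>
        from less.hyps[OF this inv'] show ?thesis by (rule wins_mono) (use less' in simp)
      next
        case False
        note att = tree_inv_attach[OF inv nc R False]
        let ?p = "Position (Suc (revealed p)) (built p)"
        \<comment> \<open>The count applied to the invariant after the reveal shows that one more
          vertex is available.\<close>
        have "Suc (revealed p) \<le> k + vertex_bound" using tree_inv_revealed_le[OF att(2)] by simp
        then obtain d where d: "k + vertex_bound - revealed p = Suc d"
          "k + vertex_bound - Suc (revealed p) = d" by (metis Suc_diff_Suc Suc_le_lessD)
        have less': "?meas (Position k []) ?p < ?meas q p" by (simp add: d del: diff_Suc_Suc)
        have "?wins (?meas (Position k []) ?p) ?p" by (rule less.hyps[OF less' att(2)])
        with less' have "\<exists>n'<?meas q p. ?wins n' (make_move (\<lambda>_ _. c) p Reveal)" for c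
          unfolding make_move.simps by blast
        from winsI[OF att(1) _ this] ts_nonempty show ?thesis by simp
      qed
    next
      case E: (Build e)
      note b = tree_inv_build[OF inv nc E]
      let ?g = "insert (revealed p) (label \<Lambda> q ` e)"
      show ?thesis
      proof (rule winsI[OF b(1)])
        fix c assume "c < length (map Suc ts)"
        then have c: "c < length ts" by simp
        let ?q = "Position (revealed q) (built q @ [(e, c)])" and ?p = "Position (revealed p) (built p @ [(?g, c)])"
        have "revealed q \<le> k + length (built q)" using reach_revealed_le[OF q] by simp
        then have less': "?meas ?q ?p < ?meas q p" using lq by simp
        have "?wins (?meas ?q ?p) ?p" by (rule less.hyps[OF less' b(2)[OF c]])
        with less' show "\<exists>n'<?meas q p. ?wins n' (make_move (\<lambda>_ _. c) p (Build ?g))"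
          unfolding make_move.simps by blast
      qed (use ts_nonempty in simp)
    qed
  qed
qed

text \<open>The invariant starts with \<open>k + 1\<close> revealed vertices. The opening reveals
  are legal because only rounds from \<open>k + 1\<close> on must contain an edge.\<close>

lemma builder_forces_Suc:
  "\<exists>\<beta>. builder_forces (Suc k) (map Suc ts) \<beta>
    (\<lambda>p. revealed p \<le> k + vertex_bound \<and> length (built p) \<le> m * vertex_bound)"
    (is "\<exists>\<beta>. builder_forces _ _ \<beta> ?P")
proof -
  let ?wins = "wins (Suc k) (map Suc ts) ?P"
  obtain n where n: "?wins n (Position (Suc k) [])"
    using wins_if_tree_inv[OF tree_inv_initial] by blast
  have "?wins (n + j) (Position (Suc k - j) [])" if "j \<le> Suc k" for j
    using that
  proof (induction j)
    case (Suc j)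
    then have eq: "Suc (Suc k - Suc j) = Suc k - j" by simp
    show ?case unfolding add_Suc_right
      by (rule wins_SucI[where mv = Reveal]) (use Suc eq in simp_all)
  qed (use n in simp)
  from this[of "Suc k"] have "?wins (n + Suc k) (Position 0 [])" by (simp del: wins.simps)
  then show ?thesis by (rule builder_forces_if_wins)
qed

end

section \<open>Existence of forcing strategies\<close>

lemma builder_forces_mono:
  assumes "builder_forces k ts \<beta> P" "\<And>p. P p \<Longrightarrow> Q p"
  shows "builder_forces k ts \<beta> Q"
  using assms unfolding builder_forces_def by blast

text \<open>Builder builds the singleton of each new vertex, so each of the \<open>d\<close>
  remaining rounds takes two moves. After \<open>sum_list ts\<close> rounds the pigeonhole principle
  gives a colour \<open>c\<close> used at least \<open>ts ! c\<close> times.\<close>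

lemma wins_1_uniform:
  assumes "ts \<noteq> []" "sum_list ts = r + d" "length B = r"
    and "fst ` set B = (\<lambda>i. {i}) ` {1..r}" "snd ` set B \<subseteq> {..<length ts}"
  shows "wins 1 ts (\<lambda>p. length (built p) \<le> sum_list ts) (2 * d) (Position r B)"
  using assms
proof (induction d arbitrary: r B)
  case 0
  have "\<exists>c<length ts. ({i}, c) \<in> set B" if i: "i \<in> {1..r}" for i
  proof -
    have "{i} \<in> fst ` set B" using "0.prems"(4) i by blast
    then obtain c where "({i}, c) \<in> set B" by auto
    then show ?thesis using "0.prems"(5) by force
  qed
  then obtain g where g: "\<And>i. i \<in> {1..r} \<Longrightarrow> g i < length ts \<and> ({i}, g i) \<in> set B" by metis
  define V where "V c = {i \<in> {1..r}. g i = c}" for c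
  have "\<exists>c<length ts. ts ! c \<le> card (V c)"
  proof (rule ccontr)
    assume "\<not> ?thesis"
    then have "(\<Sum>c<length ts. card (V c)) < (\<Sum>c<length ts. ts ! c)"
      using "0.prems"(1) by (intro sum_strict_mono) (auto simp: not_le)
    also have "\<dots> = r" using "0.prems"(2) by (simp add: sum_list_sum_nth atLeast0LessThan)
    finally have "(\<Sum>c<length ts. card (V c)) < r" .
    moreover have "card (\<Union>c\<in>{..<length ts}. V c) = (\<Sum>c<length ts. card (V c))"
      by (rule card_UN_disjoint) (auto simp: V_def)
    moreover have "(\<Union>c\<in>{..<length ts}. V c) = {1..r}" using g by (auto simp: V_def)
    ultimately show False by simp
  qed
  then obtain c where c: "c < length ts" "ts ! c \<le> card (V c)" by blast
  then obtain H where H: "H \<subseteq> V c" "card H = ts ! c" "finite H"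
    by (metis obtain_subset_with_card_n)
  have "H \<in> nsets {1..r} (ts ! c)" using H by (auto simp: nsets_def V_def)
  moreover have "(e, c) \<in> set B" if e: "e \<in> nsets H 1" for e
  proof -
    obtain x where "e = {x}" "x \<in> H" using e by (auto simp: nsets_def card_1_singleton_iff)
    then show ?thesis using g H(1) by (auto simp: V_def)
  qed
  ultimately show ?case using c "0.prems" by (auto simp: has_mono_clique_def)
next
  case (Suc d)
  let ?P = "\<lambda>p. length (built p) \<le> sum_list ts"
  have "wins 1 ts ?P (2 * d) (Position (Suc r) (B @ [({Suc r}, c)]))" if "c < length ts" for c
    using Suc.prems that by (intro Suc.IH) (auto simp: atLeastAtMostSuc_conv)
  moreover have "legal_move 1 (Position (Suc r) B) (Build {Suc r})"
    using Suc.prems(4) by (auto simp: nsets_def)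
  ultimately have "wins 1 ts ?P (Suc (2 * d)) (Position (Suc r) B)"
    by (intro wins_SucI[where mv = "Build {Suc r}"]) simp_all
  moreover have "legal_move 1 (Position r B) Reveal"
  proof (cases "r = 0")
    case False
    then have "{r} \<in> fst ` set B" using Suc.prems(4) by auto
    then show ?thesis by force
  qed simp
  ultimately have "wins 1 ts ?P (Suc (Suc (2 * d))) (Position r B)"
    by - (rule wins_SucI[where mv = Reveal], simp_all del: wins.simps)
  then show ?case by simp
qed

text \<open>Induction on the uniformity, with the tree construction itself as the induction step. It
  ensures that the minimum in \<open>online_ramsey_number\<close> is attained.\<close>

lemma builder_forces_exists:
  assumes "1 \<le> k" "ts \<noteq> []" "\<forall>t\<in>set ts. k \<le> t"
  shows "\<exists>m \<beta>. builder_forces k ts \<beta> (\<lambda>p. length (built p) \<le> m)"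
  using assms
proof (induction k arbitrary: ts rule: nat_induct_at_least)
  case base
  have "wins 1 ts (\<lambda>p. length (built p) \<le> sum_list ts) (2 * sum_list ts) (Position 0 [])"
    using base by (intro wins_1_uniform) auto
  then show ?case using builder_forces_if_wins by blast
next
  case (Suc k)
  define us where "us = map (\<lambda>t. t - 1) ts"
  have us: "us \<noteq> []" "\<forall>u\<in>set us. k \<le> u" using Suc.prems by (auto simp: us_def)
  then obtain m \<beta> where "builder_forces k us \<beta> (\<lambda>p. length (built p) \<le> m)"
    using Suc.IH by blast
  then interpret forcing_builder k us \<beta> m
    using us Suc.hyps by unfold_locales auto
  have "map Suc us = ts" using Suc.prems(2) by (auto simp: us_def intro!: map_idI)
  then obtain \<beta>' where "builder_forces (Suc k) ts \<beta>'
      (\<lambda>p. revealed p \<le> k + vertex_bound \<and> length (built p) \<le> m * vertex_bound)"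
    using builder_forces_Suc by auto
  then have "builder_forces (Suc k) ts \<beta>' (\<lambda>p. length (built p) \<le> m * vertex_bound)"
    by (rule builder_forces_mono) simp
  then show ?case by blast
qed

lemma online_ramsey_number_forces:
  assumes "1 \<le> k" "ts \<noteq> []" "\<forall>t\<in>set ts. k \<le> t"
  shows "\<exists>\<beta>. builder_forces k ts \<beta> (\<lambda>p. length (built p) \<le> online_ramsey_number k ts)"
  unfolding online_ramsey_number_def by (rule LeastI_ex) (rule builder_forces_exists[OF assms])

section \<open>Lower bounds and ordinary Ramsey numbers\<close>

lemma play_colour: "(e, c) \<in> set (built (play \<beta> \<pi> n)) \<Longrightarrow> \<exists>p. c = \<pi> p e"
proof (induction n)
  case (Suc n)
  then show ?case by (cases "\<beta> (play \<beta> \<pi> n)") auto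
qed simp

lemma le_binomial: "0 < k \<Longrightarrow> k < n \<Longrightarrow> n \<le> n choose k"
proof (induction n arbitrary: k)
  case (Suc n)
  obtain j where j: "k = Suc j" using Suc.prems by (cases k) auto
  show ?case
  proof (cases "j = 0 \<or> k = n")
    case True
    then show ?thesis using j by (auto simp: binomial_Suc_n)
  next
    case False
    then have "n \<le> n choose j" "n \<le> n choose k" using Suc j by auto
    then show ?thesis using Suc.prems j by simp
  qed
qed simp

text \<open>Against the painter that always answers \<open>c\<close>, only a clique of colour
  \<open>c\<close> can arise, and all its edges must have been built.\<close>

lemma binomial_le_if_forces:
  assumes "builder_forces k ts \<beta> (\<lambda>p. length (built p) \<le> m)" "0 < k" "\<forall>t\<in>set ts. k \<le> t" "c < length ts"
  shows "ts ! c choose k \<le> m"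
proof -
  have "painter_strategy ts (\<lambda>_ _. c)" using assms(4) by (simp add: painter_strategy_def)
  then obtain n where n: "has_mono_clique k ts (play \<beta> (\<lambda>_ _. c) n)" "length (built (play \<beta> (\<lambda>_ _. c) n)) \<le> m"
    using assms(1) unfolding builder_forces_def by blast
  let ?B = "built (play \<beta> (\<lambda>_ _. c) n)"
  obtain c' A H where H: "c' < length ts" "H \<in> nsets A (ts ! c')" "\<forall>e\<in>nsets H k. (e, c') \<in> set ?B"
    using n(1) by (auto simp: has_mono_clique_def)
  have HC: "finite H" "card H = ts ! c'" using H(2) by (auto simp: nsets_def)
  have "k \<le> ts ! c'" using H(1) assms(3) by simp
  then obtain e where "e \<subseteq> H" "card e = k" "finite e"
    using HC obtain_subset_with_card_n[of k H] by auto
  then have "e \<in> nsets H k" by (simp add: nsets_def)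
  then have "c' = c" using H(3) play_colour[of e c' \<beta> "\<lambda>_ _. c" n] by blast
  then have "ts ! c choose k = card (nsets H k)" using HC by simp
  also have "nsets H k \<subseteq> fst ` set ?B" using H(3) by force
  then have "card (nsets H k) \<le> card (fst ` set ?B)" by (intro card_mono) auto
  also have "\<dots> \<le> length ?B" by (metis card_image_le card_length finite_set le_trans)
  finally show ?thesis using n(2) by simp
qed

text \<open>Painter may answer according to a given colouring \<open>f\<close>; the clique that
  builder then forces within \<open>N\<close> vertices is monochromatic under
  \<open>f\<close>.\<close>

lemma partn_lst_if_forces:
  assumes "builder_forces k ts \<beta> (\<lambda>p. revealed p \<le> N)" "ts \<noteq> []"
  shows "partn_lst {..<N} ts k"
  unfolding partn_lst_def monochromatic_def
proof clarify
  fix f assume f: "f \<in> nsets {..<N} k \<rightarrow> {..<length ts}"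
  let ?d = "\<lambda>i::nat. i - 1"
  \<comment> \<open>The game numbers vertices from 1 and \<open>{..<N}\<close> from 0, hence the
    shift. The default \<open>0\<close> is a colour since \<open>ts\<close> is nonempty.\<close>
  define \<pi> where "\<pi> p e = (if ?d ` e \<in> nsets {..<N} k then f (?d ` e) else 0)" for p :: position and e
  have "painter_strategy ts \<pi>" using f assms(2) by (auto simp: painter_strategy_def \<pi>_def)
  then obtain n where n: "has_mono_clique k ts (play \<beta> \<pi> n)" "revealed (play \<beta> \<pi> n) \<le> N"
    using assms(1) unfolding builder_forces_def by blast
  then obtain c H where H: "c < length ts" "H \<in> nsets {1..revealed (play \<beta> \<pi> n)} (ts ! c)"
    "\<forall>e\<in>nsets H k. (e, c) \<in> set (built (play \<beta> \<pi> n))"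
    by (auto simp: has_mono_clique_def)
  have HS: "H \<subseteq> {1..N}" "finite H" "card H = ts ! c" using H(2) n(2) by (auto simp: nsets_def)
  have inj: "inj_on ?d H" 
  proof (rule inj_onI)
    fix x y assume "x \<in> H" "y \<in> H" "x - 1 = y - 1"
    then show "x = y" using subsetD[OF HS(1), of x] subsetD[OF HS(1), of y] by auto
  qed
  have "?d ` H \<subseteq> {..<N}" using HS(1) by force
  then have dH: "?d ` H \<in> nsets {..<N} (ts ! c)"
    using HS inj by (auto simp: nsets_def card_image)
  have "f e = c" if e: "e \<in> nsets (?d ` H) k" for e
  proof -
    obtain e' where e': "e' \<subseteq> H" "e = ?d ` e'" using e by (auto simp: nsets_def subset_image_iff)
    have "card e' = card e" using e' inj by (metis card_image inj_on_subset)
    then have "e' \<in> nsets H k" using e e' HS(2) finite_subset by (auto simp: nsets_def)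
    then obtain p where "c = \<pi> p e'" using H(3) play_colour by blast
    moreover have "?d ` e' \<in> nsets {..<N} k" using e e' \<open>?d ` H \<subseteq> {..<N}\<close> by (auto simp: nsets_def)
    ultimately show ?thesis using e' by (simp add: \<pi>_def)
  qed
  then have "f ` nsets (?d ` H) k \<subseteq> {c}" by blast
  then show "\<exists>c<length ts. \<exists>H\<in>nsets {..<N} (ts ! c). f ` nsets H k \<subseteq> {c}"
    using H(1) dH by blast
qed

text \<open>This makes \<open>m\<close> tend to infinity with \<open>max s t\<close>, uniformly in
  \<open>k\<close>, as the error term requires.\<close>

lemma online_ramsey_number_ge:
  assumes "2 \<le> k" "k < s" "k < t"
  shows "max s t - 1 \<le> online_ramsey_number (k - 1) [s - 1, t - 1]" (is "_ \<le> ?m")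
proof -
  have ks: "1 \<le> k - 1" "[s - 1, t - 1] \<noteq> []" "\<forall>u\<in>set [s - 1, t - 1]. k - 1 \<le> u"
    using assms by auto
  obtain \<beta> where "builder_forces (k - 1) [s - 1, t - 1] \<beta> (\<lambda>p. length (built p) \<le> ?m)"
    using online_ramsey_number_forces[OF ks] by blast
  from binomial_le_if_forces[OF this, of 0] binomial_le_if_forces[OF this, of 1]
  have "(s - 1) choose (k - 1) \<le> ?m" "(t - 1) choose (k - 1) \<le> ?m"
    using ks assms by simp_all
  moreover have "s - 1 \<le> (s - 1) choose (k - 1)" "t - 1 \<le> (t - 1) choose (k - 1)"
    using assms by (auto intro!: le_binomial)
  ultimately show ?thesis by (auto simp: max_def)
qed

section \<open>The bounds for two colours\<close>

lemma builder_forces_2_colours: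
  assumes "2 \<le> k" "k < s" "k < t"
  defines "m \<equiv> online_ramsey_number (k - 1) [s - 1, t - 1]"
  shows "\<exists>\<beta>. builder_forces k [s, t] \<beta>
    (\<lambda>p. revealed p \<le> 2 ^ m + k - 2 \<and> length (built p) \<le> m * 2 ^ m)"
proof -
  have ks: "1 \<le> k - 1" "[s - 1, t - 1] \<noteq> []" "\<forall>u\<in>set [s - 1, t - 1]. k - 1 \<le> u"
    using assms by auto
  obtain \<beta> where "builder_forces (k - 1) [s - 1, t - 1] \<beta> (\<lambda>p. length (built p) \<le> m)"
    using online_ramsey_number_forces[OF ks] unfolding m_def by blast
  then interpret forcing_builder "k - 1" "[s - 1, t - 1]" \<beta> m
    using assms by unfold_locales auto
  have vb: "vertex_bound = 2 ^ m - 1"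
    unfolding vertex_bound_def atLeast0LessThan[symmetric] sum_power2[symmetric]
    by (simp add: numeral_2_eq_2)
  \<comment> \<open>No subtraction truncates, since \<open>2 ^ m\<close> is at least 1 and
    \<open>k\<close> at least 2.\<close>
  have "k - 1 + vertex_bound = 2 ^ m + k - 2"
    using assms(1) one_le_power[of "2::nat" m] unfolding vb by linarith
  moreover have "m * vertex_bound \<le> m * 2 ^ m" unfolding vb by (intro mult_le_mono2) simp
  moreover have "Suc (k - 1) = k" "map Suc [s - 1, t - 1] = [s, t]" using assms by auto
  ultimately obtain \<beta>' where \<beta>': "builder_forces k [s, t] \<beta>'
      (\<lambda>p. revealed p \<le> 2 ^ m + k - 2 \<and> length (built p) \<le> m * vertex_bound)"
    using builder_forces_Suc by auto
  have "builder_forces k [s, t] \<beta>'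
      (\<lambda>p. revealed p \<le> 2 ^ m + k - 2 \<and> length (built p) \<le> m * 2 ^ m)"
    using \<beta>' by (rule builder_forces_mono) (use \<open>m * vertex_bound \<le> m * 2 ^ m\<close> in linarith)
  then show ?thesis by blast
qed

text \<open>The o(1) term is a function \<epsilon> of all three parameters; the filter depends on
  \<open>max s t\<close> alone, so the convergence is uniform in \<open>k\<close>.\<close>

theorem theorem1p1:
  shows "(\<forall>k s t :: nat. 2 \<le> k \<and> k < s \<and> k < t \<longrightarrow>
           (let m = online_ramsey_number (k - 1) [s - 1, t - 1] in
              (\<exists>\<beta>. builder_forces k [s, t] \<beta>
                     (\<lambda>p. revealed p \<le> 2 ^ m + k - 2 \<and> length (built p) \<le> m * 2 ^ m)) \<and>
              ramsey_number k [s, t] \<le> 2 ^ m + k - 2 \<and>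
              online_ramsey_number k [s, t] \<le> m * 2 ^ m)) \<and>
         (\<exists>\<epsilon> :: nat \<Rightarrow> nat \<Rightarrow> nat \<Rightarrow> real.
           (\<forall>k s t. 2 \<le> k \<and> k < s \<and> k < t \<longrightarrow>
              (let m = online_ramsey_number (k - 1) [s - 1, t - 1] in
                 real (m * 2 ^ m) = 2 powr ((1 + \<epsilon> k s t) * real m))) \<and>
           ((\<lambda>(k, s, t). \<epsilon> k s t) \<longlongrightarrow> 0) (filtercomap (\<lambda>(k, s, t). max s t) at_top))"
proof (intro conjI allI impI)
  fix k s t :: nat assume kst: "2 \<le> k \<and> k < s \<and> k < t"
  define m where "m = online_ramsey_number (k - 1) [s - 1, t - 1]"
  obtain \<beta> where \<beta>: "builder_forces k [s, t] \<beta>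
      (\<lambda>p. revealed p \<le> 2 ^ m + k - 2 \<and> length (built p) \<le> m * 2 ^ m)"
    using builder_forces_2_colours[of k s t] kst unfolding m_def by blast
  have "builder_forces k [s, t] \<beta> (\<lambda>p. revealed p \<le> 2 ^ m + k - 2)"
    using \<beta> by (rule builder_forces_mono) simp
  then have "ramsey_number k [s, t] \<le> 2 ^ m + k - 2"
    unfolding ramsey_number_def by (intro Least_le partn_lst_if_forces) auto
  moreover have "builder_forces k [s, t] \<beta> (\<lambda>p. length (built p) \<le> m * 2 ^ m)"
    using \<beta> by (rule builder_forces_mono) simp
  then have "online_ramsey_number k [s, t] \<le> m * 2 ^ m"
    unfolding online_ramsey_number_def by (intro Least_le) blast
  ultimately show "let m = online_ramsey_number (k - 1) [s - 1, t - 1] in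
      (\<exists>\<beta>. builder_forces k [s, t] \<beta>
             (\<lambda>p. revealed p \<le> 2 ^ m + k - 2 \<and> length (built p) \<le> m * 2 ^ m)) \<and>
      ramsey_number k [s, t] \<le> 2 ^ m + k - 2 \<and>
      online_ramsey_number k [s, t] \<le> m * 2 ^ m"
    using \<beta> unfolding Let_def m_def by blast
next
  define M where "M k s t = online_ramsey_number (k - 1) [s - 1, t - 1]" for k s t
  \<comment> \<open>As \<open>m * 2 ^ m\<close> is 2 to the power \<open>m + log 2 m\<close>, the
    error is \<open>log 2 m / m\<close>. The value 0 outside the admissible range lets the limit run
    over all triples.\<close>
  define \<epsilon> where "\<epsilon> k s t =
    (if 2 \<le> k \<and> k < s \<and> k < t then log 2 (real (M k s t)) / real (M k s t) else 0)" for k s t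
  have M: "max s t - 1 \<le> M k s t" if "2 \<le> k \<and> k < s \<and> k < t" for k s t
    unfolding M_def using online_ramsey_number_ge that by blast
  have eq: "real (M k s t * 2 ^ M k s t) = 2 powr ((1 + \<epsilon> k s t) * real (M k s t))"
    if kst: "2 \<le> k \<and> k < s \<and> k < t" for k s t
  proof -
    have pos: "0 < M k s t" using M[OF kst] kst by auto
    then have "(1 + \<epsilon> k s t) * real (M k s t) = real (M k s t) + log 2 (real (M k s t))"
      using kst by (simp add: \<epsilon>_def field_simps)
    then show ?thesis using pos by (simp add: powr_add powr_realpow)
  qed
  have lim: "((\<lambda>(k, s, t). \<epsilon> k s t) \<longlongrightarrow> 0) (filtercomap (\<lambda>(k, s, t). max s t) at_top)"
  proof (rule tendstoI)
    fix e :: real assume e: "0 < e"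
    have "((\<lambda>n::nat. ln (real n) / real n) \<longlongrightarrow> 0) at_top"
      using filterlim_compose[OF ln_x_over_x_tendsto_0 filterlim_real_sequentially] .
    then have "((\<lambda>n::nat. ln (real n) / real n / ln 2) \<longlongrightarrow> 0 / ln 2) at_top"
      by (intro tendsto_divide tendsto_const) auto
    then have "((\<lambda>n::nat. log 2 (real n) / real n) \<longlongrightarrow> 0) at_top"
      by (simp add: log_def mult.commute)
    then have "eventually (\<lambda>n::nat. dist (log 2 (real n) / real n) 0 < e) at_top"
      using e by (rule tendstoD)
    then obtain n0 where n0: "\<And>n. n0 \<le> n \<Longrightarrow> dist (log 2 (real n) / real n) 0 < e"
      by (auto simp: eventually_sequentially)
    have "dist (\<epsilon> k s t) 0 < e" if "Suc n0 \<le> max s t" for k s t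
    proof (cases "2 \<le> k \<and> k < s \<and> k < t")
      case True
      then have "n0 \<le> M k s t" using M[OF True] that by linarith
      then show ?thesis using n0 True by (simp add: \<epsilon>_def)
    qed (use e in \<open>auto simp: \<epsilon>_def\<close>)
    then show "\<forall>\<^sub>F x in filtercomap (\<lambda>(k, s, t). max s t) at_top. dist (case x of (k, s, t) \<Rightarrow> \<epsilon> k s t) 0 < e"
      unfolding eventually_filtercomap
      by (intro exI[of _ "\<lambda>n. Suc n0 \<le> n"]) (auto simp: eventually_ge_at_top)
  qed
  show "\<exists>\<epsilon> :: nat \<Rightarrow> nat \<Rightarrow> nat \<Rightarrow> real.
     (\<forall>k s t. 2 \<le> k \<and> k < s \<and> k < t \<longrightarrow>
        (let m = online_ramsey_number (k - 1) [s - 1, t - 1] in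
           real (m * 2 ^ m) = 2 powr ((1 + \<epsilon> k s t) * real m))) \<and>
     ((\<lambda>(k, s, t). \<epsilon> k s t) \<longlongrightarrow> 0) (filtercomap (\<lambda>(k, s, t). max s t) at_top)"
    using eq lim unfolding M_def Let_def by blast
qed

end
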